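(* Let $V$, $H$, $\widetilde{H}$ be complex Hilbert spaces, let $j \colon V \to H$ be a continuous linear map and $\tilde{j} \colon V \to \widetilde{H}$ a compact linear map. Let $\mathfrak{a}$ and, for all $n \in \mathbb{N}$, $\mathfrak{a}_n$ be continuous symmetric sesquilinear forms $V \times V \to \mathbb{C}$. Suppose that the sequence $(\mathfrak{a}_n)_{n \in \mathbb{N}}$ is uniformly $\tilde{j}$-elliptic and converges weakly to $\mathfrak{a}$. Moreover, suppose that $V(\mathfrak{a}) \cap \ker j = \{0\}$. Let $A_n$ be the graph associated with $(\mathfrak{a}_n,j)$. Then the graphs $A_n$ are bounded below uniformly in $n \in \mathbb{N}$.
   Context: Sesquilinear forms are linear in the first and antilinear in the second variable, and $\mathfrak{a}(u) := \mathfrak{a}(u,u)$. The sequence $(\mathfrak{a}_n)$ is uniformly $\tilde{j}$-elliptic if there exist $\mu,\omega > 0$ such that $\mathfrak{a}_n(u) + \omega \|\tilde{j}(u)\|_{\widetilde{H}}^2 \geq \mu \|u\|_V^2$ for all $n \in \mathbb{N}$ and $u \in V$. The sequence $(\mathfrak{a}_n)$ converges weakly to $\mathfrak{a}$ if $\lim_{n\to\infty} \mathfrak{a}_n(u_n,v) = \mathfrak{a}(u,v)$ for all $v \in V$ and all $u,u_1,u_2,\ldots \in V$ with $u_n \to u$ weakly in $V$. $V(\mathfrak{a}) := \{u \in V : \mathfrak{a}(u,v) = 0 \text{ for all } v \in \ker j\}$. The graph associated with a form $\mathfrak{b}$ on $V$ and $j$ is the linear subspace $$\{(x,y) \in H \times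 H : \text{there exists } u \in V \text{ such that } j(u) = x \text{ and } \mathfrak{b}(u,v) = (y,j(v))_H \text{ for all } v \in V\}$$ of $H \times H$. Graphs $A_n$ are bounded below uniformly in $n$ if there exists $\omega \in \mathbb{R}$ such that $(x,y)_H + \omega \|x\|_H^2 \geq 0$ for all $n \in \mathbb{N}$ and all $(x,y) \in A_n$ (here $(x,y)_H \in \mathbb{R}$ for $(x,y) \in A_n$, since the $A_n$ are self-adjoint graphs). *)

theory Defs
  imports "HOL-Analysis.Analysis"
begin

text \<open>
  Complex Hilbert spaces. The distribution only provides real inner product spaces, so the complex
  structure is added to the class \<^class>\<open>real_inner\<close>, whose real inner product is required to be the
  real part of the complex one. Thus the norm is the one induced by \<open>cinner\<close>, and \<open>cinner\<close> is
  positive definite (see \<open>cinner_self\<close> and \<open>cinner_self_eq_0\<close> below). The complex inner product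
  is linear in the first and antilinear in the second variable.
\<close>

class complex_inner = real_inner +
  fixes scaleC :: "complex \<Rightarrow> 'a \<Rightarrow> 'a" (infixr "*\<^sub>C" 75)
    and cinner :: "'a \<Rightarrow> 'a \<Rightarrow> complex"
  assumes scaleC_add_right: "c *\<^sub>C (x + y) = c *\<^sub>C x + c *\<^sub>C y"
    and scaleC_add_left: "(c + d) *\<^sub>C x = c *\<^sub>C x + d *\<^sub>C x"
    and scaleC_scaleC: "c *\<^sub>C d *\<^sub>C x = (c * d) *\<^sub>C x"
    and scaleC_of_real: "complex_of_real r *\<^sub>C x = r *\<^sub>R x"
    and cinner_commute: "cinner x y = cnj (cinner y x)"
    and cinner_add_left: "cinner (x + y) z = cinner x z + cinner y z"
    and cinner_scaleC_left: "cinner (c *\<^sub>C x) y = c * cinner x y"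
    and inner_eq_Re_cinner: "x \<bullet> y = Re (cinner x y)"

class chilbert_space = complex_inner + complete_space

instantiation complex :: chilbert_space
begin

definition scaleC_complex :: "complex \<Rightarrow> complex \<Rightarrow> complex" where
  "scaleC_complex c x = c * x"

definition cinner_complex :: "complex \<Rightarrow> complex \<Rightarrow> complex" where
  "cinner_complex x y = x * cnj y"

instance
  by standard
    (simp_all add: scaleC_complex_def cinner_complex_def inner_complex_def algebra_simps
      scaleR_conv_of_real)

end

lemma cinner_self: "cinner x x = complex_of_real ((norm x)\<^sup>2)"
proof (rule complex_eqI)
  show "Re (cinner x x) = Re (complex_of_real ((norm x)\<^sup>2))"
    by (simp add: power2_norm_eq_inner inner_eq_Re_cinner)
  have "Im (cinner x x) = - Im (cinner x x)"
    by (subst cinner_commute) simp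
  then show "Im (cinner x x) = Im (complex_of_real ((norm x)\<^sup>2))"
    by simp
qed

lemma cinner_self_eq_0: "cinner x x = 0 \<longleftrightarrow> x = 0"
  by (simp add: cinner_self)

abbreviation clinear :: "('a::complex_inner \<Rightarrow> 'b::complex_inner) \<Rightarrow> bool" where
  "clinear \<equiv> Vector_Spaces.linear scaleC scaleC"

definition continuous_clinear :: "('a::complex_inner \<Rightarrow> 'b::complex_inner) \<Rightarrow> bool" where
  "continuous_clinear f \<longleftrightarrow> clinear f \<and> continuous_on UNIV f"

definition compact_clinear :: "('a::complex_inner \<Rightarrow> 'b::complex_inner) \<Rightarrow> bool" where
  "compact_clinear f \<longleftrightarrow> clinear f \<and> (\<forall>B. bounded B \<longrightarrow> compact (closure (f ` B)))"

definition weakly_tendsto :: "(nat \<Rightarrow> 'a::complex_inner) \<Rightarrow> 'a \<Rightarrow> bool" where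
  "weakly_tendsto u l \<longleftrightarrow>
    (\<forall>f :: 'a \<Rightarrow> complex. continuous_clinear f \<longrightarrow> (\<lambda>n. f (u n)) \<longlonglongrightarrow> f l)"

definition sesquilinear :: "('a::complex_inner \<Rightarrow> 'a \<Rightarrow> complex) \<Rightarrow> bool" where
  "sesquilinear a \<longleftrightarrow>
    (\<forall>u u' v. a (u + u') v = a u v + a u' v) \<and>
    (\<forall>c u v. a (c *\<^sub>C u) v = c * a u v) \<and>
    (\<forall>u v v'. a u (v + v') = a u v + a u v') \<and>
    (\<forall>c u v. a u (c *\<^sub>C v) = cnj c * a u v)"

definition continuous_symmetric_form :: "('a::complex_inner \<Rightarrow> 'a \<Rightarrow> complex) \<Rightarrow> bool" where
  "continuous_symmetric_form a \<longleftrightarrow>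
    sesquilinear a \<and>
    continuous_on UNIV (\<lambda>(u, v). a u v) \<and>
    (\<forall>u v. a u v = cnj (a v u))"

text \<open>
  Only applied to symmetric forms, for which \<open>a n u u\<close> is real; hence the real part below.
\<close>

definition uniformly_elliptic ::
    "('a::complex_inner \<Rightarrow> 'c::complex_inner) \<Rightarrow> (nat \<Rightarrow> 'a \<Rightarrow> 'a \<Rightarrow> complex) \<Rightarrow> bool" where
  "uniformly_elliptic jt a \<longleftrightarrow>
    (\<exists>\<mu> \<omega> :: real. \<mu> > 0 \<and> \<omega> > 0 \<and>
      (\<forall>n u. Re (a n u u) + \<omega> * (norm (jt u))\<^sup>2 \<ge> \<mu> * (norm u)\<^sup>2))"

definition forms_converge_weakly ::
    "(nat \<Rightarrow> 'a::complex_inner \<Rightarrow> 'a \<Rightarrow> complex) \<Rightarrow> ('a \<Rightarrow> 'a \<Rightarrow> complex) \<Rightarrow> bool" where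
  "forms_converge_weakly an a \<longleftrightarrow>
    (\<forall>v u us. weakly_tendsto us u \<longrightarrow> (\<lambda>n. an n (us n) v) \<longlonglongrightarrow> a u v)"

definition null_space :: "('a \<Rightarrow> 'b::zero) \<Rightarrow> 'a set" where
  "null_space j = {v. j v = 0}"

definition V_of :: "('a::complex_inner \<Rightarrow> 'b::complex_inner) \<Rightarrow> ('a \<Rightarrow> 'a \<Rightarrow> complex) \<Rightarrow> 'a set" where
  "V_of j a = {u. \<forall>v \<in> null_space j. a u v = 0}"

definition associated_graph ::
    "('a::complex_inner \<Rightarrow> 'a \<Rightarrow> complex) \<Rightarrow> ('a \<Rightarrow> 'b::complex_inner) \<Rightarrow> ('b \<times> 'b) set" where
  "associated_graph b j = {(x, y). \<exists>u. j u = x \<and> (\<forall>v. b u v = cinner y (j v))}"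

text \<open>
  The inequality \<open>(x, y) + \<omega> \<parallel>x\<parallel>\<^sup>2 \<ge> 0\<close> between complex numbers includes that \<open>(x, y)\<close> is real.
\<close>

definition uniformly_bounded_below :: "(nat \<Rightarrow> ('b::complex_inner \<times> 'b) set) \<Rightarrow> bool" where
  "uniformly_bounded_below A \<longleftrightarrow>
    (\<exists>\<omega> :: real. \<forall>n. \<forall>(x, y) \<in> A n.
      cinner x y \<in> \<real> \<and> Re (cinner x y) + \<omega> * (norm x)\<^sup>2 \<ge> 0)"

end

theory Submission
  imports Defs
begin

text \<open>
  Write \<open>V n\<close> for \<open>V_of j (an n)\<close>. If \<open>(x, y)\<close> lies in the graph of \<open>(an n, j)\<close> and \<open>u\<close> witnesses this,
  then \<open>u\<close> lies in \<open>V n\<close> and \<open>cinner x y = an n u u\<close>. Hence it suffices to find one constant \<open>c\<close> with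
  \<open>an n u u + c * (norm (j u))\<^sup>2 \<ge> 0\<close> for all \<open>n\<close> and all \<open>u \<in> V n\<close>.

  The argument is by contradiction and compactness. Suppose that unit vectors \<open>u k\<close> violate the bounds
  with constants \<open>k\<close> for forms \<open>b k\<close> that share their ellipticity constants. A subsequence converges
  weakly to some \<open>w\<close>. Ellipticity keeps \<open>jt (u k)\<close> away from \<open>0\<close>, and \<open>jt\<close> is compact, so \<open>w \<noteq> 0\<close>.
  The violated bounds force \<open>j (u k)\<close> to tend to \<open>0\<close>, so \<open>j w = 0\<close>
  (\<open>failing_lower_bounds_weak_limit\<close>). Two cases finish the proof.

  If the bounds fail for forms \<open>an n\<close> with arbitrarily large \<open>n\<close>, then weak convergence of the forms passes the
  equations that define \<open>V n\<close> to the limit. Thus \<open>w\<close> is a nonzero element of \<open>V_of j a \<inter> null_space j\<close>,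
  contrary to hypothesis (\<open>lower_bound_eventually_uniform\<close>).

  Finitely many \<open>n\<close> remain, and each of them needs a bound of its own. The space
  \<open>W = V n \<inter> null_space j\<close> can be nontrivial here, so the previous contradiction is not available. But \<open>W\<close> is
  invisible to the bound: subtracting an element of \<open>W\<close> from \<open>u \<in> V n\<close> changes neither \<open>an n u u\<close> nor
  \<open>j u\<close>. So all \<open>u k\<close> can be taken orthogonal to \<open>W\<close>, and then \<open>w\<close> lies in \<open>W\<close> and is orthogonal
  to \<open>W\<close>, which is absurd (\<open>lower_bound_single_form\<close>).
\<close>

section \<open>Weak compactness in Hilbert spaces\<close>

text \<open>
  The parallelogram law makes every sequence in \<open>S\<close> that minimises the distance to \<open>x\<close> a Cauchy
  sequence; its limit is the point of \<open>S\<close> nearest to \<open>x\<close>.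
\<close>

lemma orthogonal_projection:
  fixes S :: "'a::{real_inner, complete_space} set"
  assumes "closed S" and "subspace S"
  obtains p where "p \<in> S" and "\<And>w. w \<in> S \<Longrightarrow> (x - p) \<bullet> w = 0"
proof -
  define D where "D = Inf ((\<lambda>s. (norm (x - s))\<^sup>2) ` S)"
  have ne: "(\<lambda>s. (norm (x - s))\<^sup>2) ` S \<noteq> {}"
    using subspace_0[OF assms(2)] by auto
  have bdd: "bdd_below ((\<lambda>s. (norm (x - s))\<^sup>2) ` S)"
    by (rule bdd_belowI[of _ 0]) auto
  have D_le: "D \<le> (norm (x - s))\<^sup>2" if "s \<in> S" for s
    unfolding D_def using that bdd by (intro cInf_lower) auto
  have "\<exists>s\<in>S. (norm (x - s))\<^sup>2 < D + 1 / real (Suc k)" for k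
    using cInf_lessD[OF ne, of "D + 1 / real (Suc k)"] unfolding D_def by auto
  then obtain q where qS: "\<And>k. q k \<in> S"
    and q: "\<And>k. (norm (x - q k))\<^sup>2 < D + 1 / real (Suc k)"
    by metis
  have parallelogram:
    "(norm (q m - q n))\<^sup>2 \<le> 2 / real (Suc m) + 2 / real (Suc n)" for m n
  proof -
    have mid: "(1/2) *\<^sub>R (q m + q n) \<in> S"
      by (intro subspace_scale[OF assms(2)] subspace_add[OF assms(2)] qS)
    have "(norm (q m - q n))\<^sup>2 + 4 * (norm (x - (1/2) *\<^sub>R (q m + q n)))\<^sup>2
        = 2 * (norm (x - q m))\<^sup>2 + 2 * (norm (x - q n))\<^sup>2"
      by (simp add: power2_norm_eq_inner inner_diff_left inner_diff_right inner_add_left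
          inner_add_right inner_commute algebra_simps)
    with D_le[OF mid] q[of m] q[of n] show ?thesis by simp
  qed
  have "Cauchy q"
  proof (rule metric_CauchyI)
    fix e :: real assume e: "0 < e"
    obtain N where N: "4 / e\<^sup>2 < real N" using reals_Archimedean2 by blast
    show "\<exists>M. \<forall>m\<ge>M. \<forall>n\<ge>M. dist (q m) (q n) < e"
    proof (intro exI allI impI)
      fix m n assume mn: "N \<le> m" "N \<le> n"
      have bound: "2 / real (Suc k) < e\<^sup>2 / 2" if "N \<le> k" for k
      proof -
        have "4 / e\<^sup>2 < real (Suc k)" using N that by simp
        then show ?thesis using e by (simp add: field_simps)
      qed
      have "(norm (q m - q n))\<^sup>2 < e\<^sup>2"
        using parallelogram[of m n] bound[OF mn(1)] bound[OF mn(2)] by simp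
      then show "dist (q m) (q n) < e"
        using e power2_less_imp_less[of "norm (q m - q n)" e] by (simp add: dist_norm)
    qed
  qed
  then obtain p where p: "q \<longlonglongrightarrow> p"
    using Cauchy_convergent convergent_def by blast
  have pS: "p \<in> S"
    using closed_sequentially[OF assms(1)] qS p by blast
  have "(norm (x - p))\<^sup>2 \<le> D + 0"
  proof (rule LIMSEQ_le)
    show "(\<lambda>k. (norm (x - q k))\<^sup>2) \<longlonglongrightarrow> (norm (x - p))\<^sup>2"
      by (intro tendsto_intros p)
    show "(\<lambda>k. D + 1 / real (Suc k)) \<longlonglongrightarrow> D + 0"
      using LIMSEQ_inverse_real_of_nat
      by (intro tendsto_add tendsto_const) (simp add: inverse_eq_divide)
    show "\<exists>N. \<forall>n\<ge>N. (norm (x - q n))\<^sup>2 \<le> D + 1 / real (Suc n)"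
      using q less_imp_le by blast
  qed
  then have pD: "(norm (x - p))\<^sup>2 = D" using D_le[OF pS] by simp
  have "(x - p) \<bullet> w = 0" if w: "w \<in> S" for w
  proof (cases "w = 0")
    case False
    \<comment> \<open>The minimiser of \<open>norm (x - p - t *\<^sub>R w)\<close> over real \<open>t\<close>.\<close>
    define t where "t = ((x - p) \<bullet> w) / (w \<bullet> w)"
    have ww: "w \<bullet> w > 0" using False by simp
    have "p + t *\<^sub>R w \<in> S"
      by (intro subspace_add[OF assms(2)] subspace_scale[OF assms(2)] pS w)
    from D_le[OF this] have "(norm (x - p))\<^sup>2 \<le> (norm ((x - p) - t *\<^sub>R w))\<^sup>2"
      by (simp add: pD algebra_simps)
    also have "\<dots> = (norm (x - p))\<^sup>2 - 2 * t * ((x - p) \<bullet> w) + t\<^sup>2 * (w \<bullet> w)"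
      using dot_norm_neg[of "x - p" "t *\<^sub>R w"]
      by (simp add: power2_norm_eq_inner[of w] power2_norm_eq_inner[of "t *\<^sub>R w"] power2_eq_square[of t] field_simps)
    also have "\<dots> = (norm (x - p))\<^sup>2 - ((x - p) \<bullet> w)\<^sup>2 / (w \<bullet> w)"
      using ww by (simp add: t_def power2_eq_square field_simps)
    finally have "((x - p) \<bullet> w)\<^sup>2 / (w \<bullet> w) \<le> 0" by simp
    then have "((x - p) \<bullet> w)\<^sup>2 \<le> 0"
      using ww by (simp add: divide_le_0_iff)
    then show ?thesis by simp
  qed simp
  with pS show ?thesis using that by blast
qed

text \<open>
  The orthogonal complement of the kernel of a nonzero functional is a line. A vector that spans it
  represents the functional after scaling.
\<close>

lemma Riesz_representation:
  fixes f :: "'a::{real_inner, complete_space} \<Rightarrow> real"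
  assumes "bounded_linear f"
  obtains y where "\<And>x. f x = x \<bullet> y"
proof (cases "\<forall>x. f x = 0")
  case True
  then show ?thesis using that[of 0] by simp
next
  case False
  then obtain x where x: "f x \<noteq> 0" by blast
  interpret bounded_linear f by fact
  have closed: "closed {v. f v = 0}"
    by (intro closed_Collect_eq continuous_on continuous_on_id continuous_on_const)
  have subspace: "subspace {v. f v = 0}"
    by (rule linear_subspace_kernel[OF bounded_linear.linear[OF assms]])
  obtain p where p: "f p = 0" "\<And>w. f w = 0 \<Longrightarrow> (x - p) \<bullet> w = 0"
    using orthogonal_projection[OF closed subspace, of x] unfolding mem_Collect_eq by metis
  define z where "z = x - p"
  have fz: "f z \<noteq> 0" using x p by (simp add: z_def diff)
  then have zz: "z \<bullet> z \<noteq> 0" using zero by auto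
  have "f v = v \<bullet> ((f z / (z \<bullet> z)) *\<^sub>R z)" for v
  proof -
    have "f (v - (f v / f z) *\<^sub>R z) = 0" using fz by (simp add: diff scaleR)
    then have "z \<bullet> (v - (f v / f z) *\<^sub>R z) = 0" using p(2) by (simp add: z_def)
    then show ?thesis using fz zz by (simp add: inner_diff_right inner_commute field_simps)
  qed
  then show ?thesis using that by blast
qed

text \<open>
  Tychonoff's theorem replaces a diagonal argument: a countable power of a compact interval is compact,
  and the product topology on it is metrizable, so it is sequentially compact.
\<close>

lemma bounded_sequence_coordinatewise_convergent:
  fixes X :: "nat \<Rightarrow> nat \<Rightarrow> real"
  assumes "\<And>k m. \<bar>X k m\<bar> \<le> B"
  obtains r where "strict_mono r" and "\<And>m. convergent (\<lambda>k. X (r k) m)"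
proof -
  let ?K = "PiE UNIV (\<lambda>_::nat. {- B..B})"
  have "compactin (product_topology (\<lambda>_. euclidean) UNIV) ?K"
    by (subst compactin_PiE) auto
  then have "compact ?K"
    by (simp add: euclidean_product_topology)
  then have "seq_compact ?K" by (rule compact_imp_seq_compact)
  moreover have "\<forall>k. X k \<in> ?K"
    using assms by (auto simp: abs_le_iff) (metis minus_le_iff)
  ultimately obtain l r where r: "strict_mono r" and l: "(X \<circ> r) \<longlonglongrightarrow> l"
    unfolding seq_compact_def by metis
  have "(\<lambda>k. (X \<circ> r) k m) \<longlonglongrightarrow> l m" for m
    by (rule continuous_on_tendsto_compose[OF continuous_on_product_coordinates l]) auto
  then show ?thesis using that r by (auto simp: convergent_def)
qed

text \<open>
  Testing the sequence against its own members is enough. After passing to a subsequence, these countably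
  many inner products converge. The vectors against which the subsequence converges form a closed
  subspace \<open>S\<close>. It contains all \<open>u m\<close>, and it contains every vector orthogonal to \<open>S\<close> because against
  such a vector the sequence vanishes. Hence \<open>S\<close> is the whole space, and the limit functional is
  represented by a vector.
\<close>

lemma bounded_sequence_weakly_convergent:
  fixes u :: "nat \<Rightarrow> 'a::{real_inner, complete_space}"
  assumes B: "\<And>k. norm (u k) \<le> B"
  obtains r w where "strict_mono r" and "\<And>z. (\<lambda>k. u (r k) \<bullet> z) \<longlonglongrightarrow> w \<bullet> z"
proof -
  have B0: "0 \<le> B" using B[of 0] norm_ge_zero order_trans by blast
  have "\<bar>u k \<bullet> u m\<bar> \<le> B * B" for k m
    using Cauchy_Schwarz_ineq2[of "u k" "u m"] mult_mono[OF B B B0 norm_ge_zero]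
    by (rule order_trans)
  then obtain r where r: "strict_mono r" and conv: "\<And>m. convergent (\<lambda>k. u (r k) \<bullet> u m)"
    using bounded_sequence_coordinatewise_convergent[of "\<lambda>k m. u k \<bullet> u m"] by blast
  define S where "S = {z. convergent (\<lambda>k. u (r k) \<bullet> z)}"
  have sub: "subspace S"
    unfolding subspace_def S_def
    by (auto simp: inner_add_right convergent_const intro: convergent_add convergent_mult)
  have "closed S"
  proof (rule closed_sequential_limits[THEN iffD2], intro allI impI, elim conjE)
    fix z l assume zS: "\<forall>n. z n \<in> S" and zl: "z \<longlonglongrightarrow> l"
    have "Cauchy (\<lambda>k. u (r k) \<bullet> l)"
    proof (rule metric_CauchyI)
      fix e :: real assume e: "0 < e"
      \<comment> \<open>The summand \<open>1\<close> keeps the denominator positive when \<open>B = 0\<close>.\<close>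
      define d where "d = e / (4 * (B + 1))"
      have d: "0 < d" "B * d \<le> e / 4" using e B0 by (simp_all add: d_def field_simps)
      obtain n where n: "norm (z n - l) < d"
        using LIMSEQ_D[OF zl d(1)] by blast
      have approx: "\<bar>u (r k) \<bullet> z n - u (r k) \<bullet> l\<bar> \<le> e / 4" for k
      proof -
        have "\<bar>u (r k) \<bullet> (z n - l)\<bar> \<le> norm (u (r k)) * norm (z n - l)"
          by (rule Cauchy_Schwarz_ineq2)
        also have "\<dots> \<le> B * d" using B n B0 by (intro mult_mono) auto
        finally show ?thesis using d by (simp add: inner_diff_right)
      qed
      have "Cauchy (\<lambda>k. u (r k) \<bullet> z n)"
        using zS by (simp add: S_def Cauchy_convergent_iff)
      then obtain M where M: "\<And>i k. i \<ge> M \<Longrightarrow> k \<ge> M \<Longrightarrow> dist (u (r i) \<bullet> z n) (u (r k) \<bullet> z n) < e / 2"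
        unfolding Cauchy_def using e by (meson half_gt_zero)
      then have "dist (u (r i) \<bullet> l) (u (r k) \<bullet> l) < e" if "i \<ge> M" "k \<ge> M" for i k
        using approx[of i] approx[of k] M[OF that] unfolding dist_real_def by linarith
      then show "\<exists>M. \<forall>m\<ge>M. \<forall>n\<ge>M. dist (u (r m) \<bullet> l) (u (r n) \<bullet> l) < e" by blast
    qed
    then show "l \<in> S" by (simp add: S_def Cauchy_convergent_iff)
  qed
  have S_UNIV: "z \<in> S" for z
  proof -
    obtain p where p: "p \<in> S" "\<And>w. w \<in> S \<Longrightarrow> (z - p) \<bullet> w = 0"
      using orthogonal_projection[OF \<open>closed S\<close> sub] by blast
    have "u m \<in> S" for m using conv by (simp add: S_def)
    then have "u (r k) \<bullet> (z - p) = 0" for k using p(2) inner_commute by metis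
    then have "z - p \<in> S" by (simp add: S_def convergent_const)
    then show ?thesis using subspace_add[OF sub p(1)] by fastforce
  qed
  define L where "L z = lim (\<lambda>k. u (r k) \<bullet> z)" for z
  have L: "(\<lambda>k. u (r k) \<bullet> z) \<longlonglongrightarrow> L z" for z
    using S_UNIV[of z] by (simp add: S_def L_def convergent_LIMSEQ_iff)
  have "bounded_linear L"
  proof (rule bounded_linear_intro)
    fix x y show "L (x + y) = L x + L y"
      using LIMSEQ_unique[OF L[of "x + y"]] tendsto_add[OF L[of x] L[of y]]
      by (simp add: inner_add_right)
  next
    fix c x show "L (c *\<^sub>R x) = c *\<^sub>R L x"
      using LIMSEQ_unique[OF L[of "c *\<^sub>R x"]] tendsto_mult_left[OF L[of x], of c] by simp
  next
    fix x
    have "\<bar>u (r k) \<bullet> x\<bar> \<le> norm x * B" for k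
      using Cauchy_Schwarz_ineq2[of "u (r k)" x] mult_right_mono[OF B, of "norm x" "r k"]
      by (simp add: mult.commute)
    then show "norm (L x) \<le> norm x * B"
      using tendsto_rabs[OF L[of x]] LIMSEQ_le_const2 by fastforce
  qed
  then obtain w where "\<And>z. L z = z \<bullet> w" using Riesz_representation by blast
  with L r that show ?thesis by (metis inner_commute)
qed

text \<open>
  A bounded operator preserves weak limits, since \<open>T x \<bullet> z\<close> is a bounded functional of \<open>x\<close>. Therefore
  a strong limit of the images can only be the image of the weak limit. Both \<open>jt\<close> and \<open>j\<close> are treated in
  this way below.
\<close>

lemma bounded_linear_weak_limit:
  fixes T :: "'a::{real_inner, complete_space} \<Rightarrow> 'b::real_inner"
  assumes "bounded_linear T"
    and weak: "\<And>z. (\<lambda>k. u k \<bullet> z) \<longlonglongrightarrow> w \<bullet> z"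
    and strong: "(\<lambda>k. T (u k)) \<longlonglongrightarrow> y"
  shows "T w = y"
proof -
  have "T w \<bullet> z = y \<bullet> z" for z
  proof -
    have "bounded_linear (\<lambda>x. T x \<bullet> z)"
      by (rule bounded_linear_compose[OF bounded_linear_inner_left assms(1)])
    then obtain v where "\<And>x. T x \<bullet> z = x \<bullet> v" using Riesz_representation by blast
    then have "(\<lambda>k. T (u k) \<bullet> z) \<longlonglongrightarrow> T w \<bullet> z" using weak by simp
    moreover have "(\<lambda>k. T (u k) \<bullet> z) \<longlonglongrightarrow> y \<bullet> z" by (intro tendsto_intros strong)
    ultimately show ?thesis by (rule LIMSEQ_unique)
  qed
  then show ?thesis by (metis vector_eq_rdot)
qed

section \<open>Complex linear maps\<close>

lemma clinear_imp_linear: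
  fixes f :: "'a::complex_inner \<Rightarrow> 'b::complex_inner"
  assumes "clinear f"
  shows "linear f"
proof -
  interpret Vector_Spaces.linear scaleC scaleC f by fact
  show ?thesis
    by (rule linearI) (simp_all add: add scale flip: scaleC_of_real)
qed

lemma linear_continuous_imp_bounded_linear:
  fixes f :: "'a::real_normed_vector \<Rightarrow> 'b::real_normed_vector"
  assumes "linear f" and "continuous_on UNIV f"
  shows "bounded_linear f"
proof -
  have "f \<midarrow>0\<rightarrow> f 0"
    using assms(2) by (simp add: continuous_on_def)
  then obtain d where d: "d > 0" "\<And>x. norm x < d \<Longrightarrow> norm (f x) < 1"
    using LIM_D[of f "f 0" 0 1] linear_0[OF assms(1)]
    by (metis diff_zero norm_zero zero_less_one)
  have "norm (f x) \<le> norm x * (2 / d)" for x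
  proof (cases "x = 0")
    case False
    have "norm (f ((d / (2 * norm x)) *\<^sub>R x)) < 1"
      using d(1) False by (intro d(2)) simp
    then show ?thesis using d(1) False
      by (simp add: linear_scale[OF assms(1)] field_simps)
  qed (simp add: linear_0[OF assms(1)])
  then show ?thesis
    using assms(1) by (intro bounded_linear_intro[of _ "2 / d"]) (simp_all add: linear_add linear_scale)
qed

lemma continuous_clinear_imp_bounded_linear:
  "continuous_clinear f \<Longrightarrow> bounded_linear f"
  by (simp add: continuous_clinear_def clinear_imp_linear linear_continuous_imp_bounded_linear)

lemma compact_clinear_imp_bounded_linear:
  fixes f :: "'a::complex_inner \<Rightarrow> 'b::complex_inner"
  assumes "compact_clinear f"
  shows "bounded_linear f"
proof -
  have lin: "linear f" using assms by (simp add: compact_clinear_def clinear_imp_linear)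
  have "bounded (closure (f ` cball 0 1))"
    using assms by (simp add: compact_clinear_def compact_imp_bounded)
  then have "bounded (f ` cball 0 1)"
    using bounded_subset closure_subset by blast
  then obtain B where B: "\<And>x. norm x \<le> 1 \<Longrightarrow> norm (f x) \<le> B"
    unfolding bounded_iff by (metis imageI mem_cball_0)
  have "norm (f x) \<le> norm x * B" for x
  proof (cases "x = 0")
    case False
    have "norm (f ((1 / norm x) *\<^sub>R x)) \<le> B"
      using False by (intro B) simp
    then show ?thesis using False by (simp add: linear_scale[OF lin] field_simps)
  qed (simp add: linear_0[OF lin])
  then show ?thesis
    using lin by (intro bounded_linear_intro[of _ B]) (simp_all add: linear_add linear_scale)
qed

text \<open>
  Real and imaginary parts of a continuous complex functional are bounded real functionals, so weak
  convergence can be tested on the real inner product alone.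
\<close>

lemma weakly_tendstoI:
  fixes u :: "nat \<Rightarrow> 'a::chilbert_space"
  assumes weak: "\<And>z. (\<lambda>k. u k \<bullet> z) \<longlonglongrightarrow> w \<bullet> z"
  shows "weakly_tendsto u w"
  unfolding weakly_tendsto_def
proof (intro allI impI)
  fix f :: "'a \<Rightarrow> complex"
  assume "continuous_clinear f"
  then have bl: "bounded_linear f" by (rule continuous_clinear_imp_bounded_linear)
  obtain y where y: "\<And>x. Re (f x) = x \<bullet> y"
    using Riesz_representation[OF bounded_linear_compose[OF bounded_linear_Re bl]] by blast
  obtain z where z: "\<And>x. Im (f x) = x \<bullet> z"
    using Riesz_representation[OF bounded_linear_compose[OF bounded_linear_Im bl]] by blast
  show "(\<lambda>n. f (u n)) \<longlonglongrightarrow> f w"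
    by (simp add: tendsto_complex_iff y z weak)
qed

section \<open>Forms\<close>

lemma sesquilinear_scaleR:
  assumes "sesquilinear b"
  shows "b (c *\<^sub>R u) v = c * b u v" "b u (c *\<^sub>R v) = c * b u v"
  using assms unfolding sesquilinear_def
  by (simp_all flip: scaleC_of_real)

lemma sesquilinear_diff:
  assumes "sesquilinear b"
  shows "b (u - u') v = b u v - b u' v" "b u (v - v') = b u v - b u v'"
proof -
  have add: "b (u + u') v = b u v + b u' v" "b u (v + v') = b u v + b u v'" for u u' v v'
    using assms unfolding sesquilinear_def by auto
  show "b (u - u') v = b u v - b u' v"
    using add(1)[of "u - u'" u' v] by simp
  show "b u (v - v') = b u v - b u v'"
    using add(2)[of u "v - v'" v'] by simp
qed

lemma vector_space_scaleC: "vector_space (scaleC :: complex \<Rightarrow> 'a::complex_inner \<Rightarrow> 'a)"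
proof
  show "1 *\<^sub>C x = x" for x :: 'a
    using scaleC_of_real[of 1 x] by simp
qed (rule scaleC_add_right scaleC_add_left scaleC_scaleC)+

lemma form_continuous_clinear:
  assumes "continuous_symmetric_form b"
  shows "continuous_clinear (\<lambda>u. b u v)"
proof -
  have sesq: "sesquilinear b" and cont: "continuous_on UNIV (\<lambda>(u, v). b u v)"
    using assms unfolding continuous_symmetric_form_def by blast+
  have "clinear (\<lambda>u. b u v)"
    using sesq
    by (simp add: Vector_Spaces.linear_iff vector_space_scaleC sesquilinear_def scaleC_complex_def)
  moreover from cont have "continuous_on UNIV (\<lambda>u. case (u, v) of (u, v) \<Rightarrow> b u v)"
    by (rule continuous_on_compose2) (auto intro!: continuous_intros)
  ultimately show ?thesis by (simp add: continuous_clinear_def)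
qed

lemma
  assumes "continuous_symmetric_form b"
  shows subspace_V_of: "subspace (V_of j b)" and closed_V_of: "closed (V_of j b)"
proof -
  have bl: "bounded_linear (\<lambda>u. b u v)" for v
    using form_continuous_clinear[OF assms] by (rule continuous_clinear_imp_bounded_linear)
  have eq: "V_of j b = (\<Inter>v\<in>null_space j. {u. b u v = 0})"
    by (auto simp: V_of_def)
  have "subspace {u. b u v = 0}" for v
    by (rule linear_subspace_kernel[OF bounded_linear.linear[OF bl]])
  then show "subspace (V_of j b)"
    unfolding eq by (intro subspace_Inter) blast
  have "closed {u. b u v = 0}" for v
    by (intro closed_Collect_eq bounded_linear.continuous_on[OF bl]
        continuous_on_id continuous_on_const)
  then show "closed (V_of j b)" unfolding eq by blast
qed

text \<open>
  Weak convergence of forms speaks of sequences indexed by all \<open>n\<close>. A sequence indexed along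
  \<open>s\<close> is extended by its weak limit \<open>w\<close> at the remaining indices.
\<close>

lemma forms_converge_weakly_subsequence:
  fixes u :: "nat \<Rightarrow> 'a::complex_inner"
  assumes "forms_converge_weakly an a" and s: "strict_mono s" and u: "weakly_tendsto u w"
  shows "(\<lambda>k. an (s k) (u k) v) \<longlonglongrightarrow> a w v"
proof -
  define x where "x m = (if m \<in> range s then u (inv s m) else w)" for m
  have inj: "inj s" using s by (rule strict_mono_imp_inj_on)
  have xs: "x (s k) = u k" for k by (simp add: x_def inv_f_f[OF inj])
  have "weakly_tendsto x w" unfolding weakly_tendsto_def
  proof (intro allI impI metric_LIMSEQ_I)
    fix f :: "'a \<Rightarrow> complex" and e :: real
    assume "continuous_clinear f" "0 < e"
    then obtain K where K: "\<And>k. k \<ge> K \<Longrightarrow> dist (f (u k)) (f w) < e"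
      using u unfolding weakly_tendsto_def by (meson metric_LIMSEQ_D)
    have "dist (f (x m)) (f w) < e" if "m \<ge> s K" for m
    proof (cases "m \<in> range s")
      case True
      then obtain k where k: "m = s k" by blast
      then have "k \<ge> K" using that s by (simp add: strict_mono_less_eq)
      then show ?thesis using K k xs by simp
    qed (simp add: x_def \<open>0 < e\<close>)
    then show "\<exists>no. \<forall>n\<ge>no. dist (f (x n)) (f w) < e" by blast
  qed
  then have "(\<lambda>m. an m (x m) v) \<longlonglongrightarrow> a w v"
    using assms(1) unfolding forms_converge_weakly_def by blast
  from LIMSEQ_subseq_LIMSEQ[OF this s] show ?thesis by (simp add: o_def xs)
qed

section \<open>Lower bounds\<close>

text \<open>
  The compactness step, in a form that serves both varying forms and a constant sequence of forms. The subspaces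
  \<open>S k\<close> record extra information about the vectors that violate the bounds. Each application
  passes this information to the weak limit in its own way.
\<close>

lemma failing_lower_bounds_weak_limit:
  fixes j :: "'v::chilbert_space \<Rightarrow> 'h::chilbert_space"
    and jt :: "'v \<Rightarrow> 'k::chilbert_space"
  assumes j: "continuous_clinear j" and jt: "compact_clinear jt"
    and sesq: "\<And>k. sesquilinear (b k)"
    and \<mu>: "\<mu> > 0" and \<omega>: "\<omega> > 0"
    and ell: "\<And>k u. Re (b k u u) + \<omega> * (norm (jt u))\<^sup>2 \<ge> \<mu> * (norm u)\<^sup>2"
    and sub: "\<And>k. subspace (S k)"
    and viol: "\<And>k. \<exists>u\<in>S k. Re (b k u u) + real k * (norm (j u))\<^sup>2 < 0"
  shows "\<exists>r u w. strict_mono r \<and> (\<forall>k. u k \<in> S (r k)) \<and>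
    (\<forall>z. (\<lambda>k. u k \<bullet> z) \<longlonglongrightarrow> w \<bullet> z) \<and> w \<noteq> 0 \<and> j w = 0"
proof -
  have blj: "bounded_linear j" using j by (rule continuous_clinear_imp_bounded_linear)
  have bljt: "bounded_linear jt" using jt by (rule compact_clinear_imp_bounded_linear)
  have "\<exists>x\<in>S k. norm x = 1 \<and> Re (b k x x) + real k * (norm (j x))\<^sup>2 < 0" for k
  proof -
    obtain u where u: "u \<in> S k" "Re (b k u u) + real k * (norm (j u))\<^sup>2 < 0"
      using viol by blast
    have "u \<noteq> 0" using u(2) ell[of u k] sesquilinear_scaleR(1)[OF sesq, of k 0 u u]
      by (auto simp: bounded_linear.linear[OF blj] linear_0)
    define c where "c = 1 / norm u"
    have c: "c > 0" "norm (c *\<^sub>R u) = 1" using \<open>u \<noteq> 0\<close> by (simp_all add: c_def)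
    have "Re (b k (c *\<^sub>R u) (c *\<^sub>R u)) + real k * (norm (j (c *\<^sub>R u)))\<^sup>2
        = c\<^sup>2 * (Re (b k u u) + real k * (norm (j u))\<^sup>2)"
      by (simp add: sesquilinear_scaleR[OF sesq] bounded_linear.linear[OF blj] linear_scale
          power2_eq_square algebra_simps)
    also have "\<dots> < 0" using c u(2) by (simp add: mult_pos_neg)
    finally show ?thesis using c subspace_scale[OF sub u(1)] by blast
  qed
  then obtain x where xS: "\<And>k. x k \<in> S k" and x1: "\<And>k. norm (x k) = 1"
    and neg: "\<And>k. Re (b k (x k) (x k)) + real k * (norm (j (x k)))\<^sup>2 < 0"
    by metis
  obtain r where r: "strict_mono r"
    and w: "\<exists>w. \<forall>z. (\<lambda>k. x (r k) \<bullet> z) \<longlonglongrightarrow> w \<bullet> z"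
    using bounded_sequence_weakly_convergent[of x 1] x1 by (metis order_refl)
  then obtain w where w: "\<And>z. (\<lambda>k. x (r k) \<bullet> z) \<longlonglongrightarrow> w \<bullet> z" by blast
  have sc: "seq_compact (closure (jt ` cball 0 1))"
    using jt by (simp add: compact_clinear_def compact_imp_seq_compact)
  have mem: "jt (x (r k)) \<in> closure (jt ` cball 0 1)" for k
    using x1 by (intro subsetD[OF closure_subset] imageI) simp
  obtain y q where q: "strict_mono q" and y: "((\<lambda>k. jt (x (r k))) \<circ> q) \<longlonglongrightarrow> y"
    using sc[unfolded seq_compact_def, rule_format, of "\<lambda>k. jt (x (r k))", OF mem] by blast
  define p where "p = r \<circ> q"
  have p: "strict_mono p" using r q by (simp add: p_def strict_mono_o)
  have wp: "(\<lambda>k. x (p k) \<bullet> z) \<longlonglongrightarrow> w \<bullet> z" for z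
    using LIMSEQ_subseq_LIMSEQ[OF w q] by (simp add: p_def o_def)
  have yp: "(\<lambda>k. jt (x (p k))) \<longlonglongrightarrow> y" using y by (simp add: p_def o_def)
  have jtw: "jt w = y" by (rule bounded_linear_weak_limit[OF bljt wp yp])
  \<comment> \<open>A violated bound makes the form negative, so ellipticity bounds \<open>jt\<close> from below.\<close>
  have "\<mu> \<le> \<omega> * (norm (jt (x k)))\<^sup>2" for k
  proof -
    have "0 \<le> real k * (norm (j (x k)))\<^sup>2" by simp
    with ell[of "x k" k] neg[of k] show ?thesis
      unfolding x1 power_one mult_1_right by linarith
  qed
  moreover have "(\<lambda>k. \<omega> * (norm (jt (x (p k))))\<^sup>2) \<longlonglongrightarrow> \<omega> * (norm y)\<^sup>2"
    by (intro tendsto_intros yp)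
  ultimately have "\<mu> \<le> \<omega> * (norm y)\<^sup>2"
    by (meson LIMSEQ_le_const)
  then have "jt w \<noteq> 0" using \<mu> jtw by auto
  then have w0: "w \<noteq> 0" using linear_0[OF bounded_linear.linear[OF bljt]] by auto
  obtain C where C: "\<And>v. norm (jt v) \<le> norm v * C"
    using bounded_linear.bounded[OF bljt] by blast
  \<comment> \<open>At unit vectors ellipticity also bounds the form below by \<open>- \<omega> * C\<^sup>2\<close>, while the coefficient \<open>k\<close> grows.\<close>
  have "(norm (j (x k)))\<^sup>2 \<le> (\<omega> * C\<^sup>2) / real k" if "k > 0" for k
  proof -
    have "(norm (jt (x k)))\<^sup>2 \<le> C\<^sup>2"
      using C[of "x k"] by (simp add: x1 power_mono)
    then have "\<omega> * (norm (jt (x k)))\<^sup>2 \<le> \<omega> * C\<^sup>2" using \<omega> by simp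
    then have "real k * (norm (j (x k)))\<^sup>2 \<le> \<omega> * C\<^sup>2"
      using ell[of "x k" k] neg[of k] \<mu> by (simp add: x1)
    then show ?thesis using that by (simp add: field_simps)
  qed
  then have ev: "\<forall>\<^sub>F k in sequentially. norm ((norm (j (x k)))\<^sup>2) \<le> (\<omega> * C\<^sup>2) / real k"
    by (auto intro: eventually_sequentiallyI[of 1])
  have "(\<lambda>k. (norm (j (x k)))\<^sup>2) \<longlonglongrightarrow> 0"
    by (rule Lim_null_comparison[OF ev lim_const_over_n])
  then have "(\<lambda>k. j (x k)) \<longlonglongrightarrow> 0"
    using tendsto_real_sqrt[of "\<lambda>k. (norm (j (x k)))\<^sup>2" 0] by (simp add: tendsto_norm_zero_iff)
  from LIMSEQ_subseq_LIMSEQ[OF this p] have "(\<lambda>k. j (x (p k))) \<longlonglongrightarrow> 0" by (simp add: o_def)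
  then have "j w = 0" by (rule bounded_linear_weak_limit[OF blj wp])
  with p xS wp w0 show ?thesis
    by (intro exI[of _ p] exI[of _ "\<lambda>k. x (p k)"] exI[of _ w]) simp
qed

text \<open>
  The kernel condition of the limit form says nothing about a single form \<open>b\<close>, and
  \<open>W = V_of j b \<inter> null_space j\<close> can be nontrivial. For \<open>u \<in> V_of j b\<close> and \<open>p \<in> W\<close> the terms
  \<open>b u p\<close>, \<open>b p u\<close> and \<open>b p p\<close> all vanish, so the bound at \<open>u\<close> is the bound at \<open>u - p\<close>. Taking for \<open>p\<close>
  the projection of \<open>u\<close> to \<open>W\<close> reduces the claim to vectors orthogonal to \<open>W\<close>.
\<close>

lemma lower_bound_single_form:
  fixes j :: "'v::chilbert_space \<Rightarrow> 'h::chilbert_space"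
    and jt :: "'v \<Rightarrow> 'k::chilbert_space"
  assumes j: "continuous_clinear j" and jt: "compact_clinear jt"
    and b: "continuous_symmetric_form b"
    and \<mu>: "\<mu> > 0" and \<omega>: "\<omega> > 0"
    and ell: "\<And>u. Re (b u u) + \<omega> * (norm (jt u))\<^sup>2 \<ge> \<mu> * (norm u)\<^sup>2"
  shows "\<exists>c. \<forall>u\<in>V_of j b. Re (b u u) + c * (norm (j u))\<^sup>2 \<ge> 0"
proof (rule ccontr)
  assume neg: "\<not> ?thesis"
  have sesq: "sesquilinear b" and sym: "\<And>u v. b u v = cnj (b v u)"
    using b unfolding continuous_symmetric_form_def by blast+
  have blj: "bounded_linear j" using j by (rule continuous_clinear_imp_bounded_linear)
  note linj = bounded_linear.linear[OF blj]
  define W where "W = V_of j b \<inter> null_space j"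
  have "closed (null_space j)" unfolding null_space_def
    by (intro closed_Collect_eq bounded_linear.continuous_on[OF blj]
        continuous_on_id continuous_on_const)
  then have closedW: "closed W" using closed_Int[OF closed_V_of[OF b]] by (simp add: W_def)
  have "subspace (null_space j)"
    unfolding null_space_def by (rule linear_subspace_kernel[OF linj])
  then have subW: "subspace W" using subspace_inter[OF subspace_V_of[OF b]] by (simp add: W_def)
  define S where "S = V_of j b \<inter> {u. \<forall>w\<in>W. orthogonal w u}"
  have subS: "subspace S"
    unfolding S_def by (intro subspace_inter subspace_V_of[OF b] subspace_orthogonal_to_vectors)
  have viol: "\<exists>u\<in>S. Re (b u u) + real k * (norm (j u))\<^sup>2 < 0" for k
  proof -
    obtain u where u: "u \<in> V_of j b" "Re (b u u) + real k * (norm (j u))\<^sup>2 < 0"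
      using neg by (meson not_le)
    obtain p where p: "p \<in> W" "\<And>w. w \<in> W \<Longrightarrow> (u - p) \<bullet> w = 0"
      using orthogonal_projection[OF closedW subW] by blast
    have pV: "p \<in> V_of j b" and pN: "p \<in> null_space j" using p(1) by (auto simp: W_def)
    have "b u p = 0" "b p p = 0" using u(1) pV pN by (auto simp: V_of_def)
    moreover from this have "b p u = 0" using sym[of p u] by simp
    ultimately have "b (u - p) (u - p) = b u u"
      by (simp add: sesquilinear_diff[OF sesq])
    moreover have "j (u - p) = j u" using pN by (simp add: linear_diff[OF linj] null_space_def)
    moreover have "u - p \<in> S"
      using subspace_diff[OF subspace_V_of[OF b] u(1) pV] p(2)
      by (auto simp: S_def orthogonal_def inner_commute)
    ultimately show ?thesis using u(2) by metis
  qed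
  obtain r u w where "strict_mono (r :: nat \<Rightarrow> nat)" and uS: "\<forall>k. u k \<in> S"
    and weak: "\<forall>z. (\<lambda>k. u k \<bullet> z) \<longlonglongrightarrow> w \<bullet> z" and w: "w \<noteq> 0" "j w = 0"
    using failing_lower_bounds_weak_limit[of j jt "\<lambda>_. b" \<mu> \<omega> "\<lambda>_. S",
        OF j jt sesq \<mu> \<omega> ell subS viol]
    by (elim exE conjE) (rule that)
  have "b w v = 0" if "v \<in> null_space j" for v
  proof -
    have "(\<lambda>k. b (u k) v) \<longlonglongrightarrow> b w v"
      using weakly_tendstoI[OF weak[rule_format]] form_continuous_clinear[OF b, of v]
      unfolding weakly_tendsto_def by blast
    moreover have "b (u k) v = 0" for k using uS that by (auto simp: S_def V_of_def)
    ultimately show ?thesis by (simp add: LIMSEQ_const_iff)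
  qed
  then have "w \<in> W" using w by (simp add: W_def V_of_def null_space_def)
  then have "u k \<bullet> w = 0" for k using uS by (auto simp: S_def orthogonal_def inner_commute)
  then have "w \<bullet> w = 0" using weak[rule_format, of w] by (simp add: LIMSEQ_const_iff)
  with w show False by simp
qed

text \<open>
  The indices at which the bounds fail have to be chosen strictly increasing: only then do the forms
  tend to \<open>a\<close> along them.
\<close>

lemma lower_bound_eventually_uniform:
  fixes j :: "'v::chilbert_space \<Rightarrow> 'h::chilbert_space"
    and jt :: "'v \<Rightarrow> 'k::chilbert_space"
  assumes j: "continuous_clinear j" and jt: "compact_clinear jt"
    and an: "\<And>n. continuous_symmetric_form (an n)"
    and \<mu>: "\<mu> > 0" and \<omega>: "\<omega> > 0"
    and ell: "\<And>n u. Re (an n u u) + \<omega> * (norm (jt u))\<^sup>2 \<ge> \<mu> * (norm u)\<^sup>2"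
    and conv: "forms_converge_weakly an a"
    and triv: "V_of j a \<inter> null_space j = {0}"
  shows "\<exists>N c. \<forall>n\<ge>N. \<forall>u\<in>V_of j (an n). Re (an n u u) + c * (norm (j u))\<^sup>2 \<ge> 0"
proof (rule ccontr)
  assume neg: "\<not> ?thesis"
  have "\<exists>s. \<forall>k. (\<exists>u\<in>V_of j (an (s k)). Re (an (s k) u u) + real k * (norm (j u))\<^sup>2 < 0)
      \<and> s k < s (Suc k)"
  proof (rule dependent_nat_choice)
    show "\<exists>n. \<exists>u\<in>V_of j (an n). Re (an n u u) + real 0 * (norm (j u))\<^sup>2 < 0"
      using neg by (meson not_le)
    show "\<exists>n. (\<exists>u\<in>V_of j (an n). Re (an n u u) + real (Suc k) * (norm (j u))\<^sup>2 < 0) \<and> m < n"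
      for m k
      using neg by (meson not_le Suc_le_eq)
  qed
  then obtain s where s: "strict_mono s"
    and viol: "\<And>k. \<exists>u\<in>V_of j (an (s k)). Re (an (s k) u u) + real k * (norm (j u))\<^sup>2 < 0"
    by (metis strict_mono_Suc_iff)
  have sesq: "sesquilinear (an n)" for n
    using an unfolding continuous_symmetric_form_def by blast
  obtain r u w where r: "strict_mono r" and uV: "\<forall>k. u k \<in> V_of j (an (s (r k)))"
    and weak: "\<forall>z. (\<lambda>k. u k \<bullet> z) \<longlonglongrightarrow> w \<bullet> z" and w: "w \<noteq> 0" "j w = 0"
    using failing_lower_bounds_weak_limit[of j jt "\<lambda>k. an (s k)" \<mu> \<omega>
        "\<lambda>k. V_of j (an (s k))", OF j jt sesq \<mu> \<omega> ell subspace_V_of[OF an] viol]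
    by (elim exE conjE) (rule that)
  have "a w v = 0" if "v \<in> null_space j" for v
  proof -
    have "(\<lambda>k. an ((s \<circ> r) k) (u k) v) \<longlonglongrightarrow> a w v"
      by (rule forms_converge_weakly_subsequence[OF conv strict_mono_o[OF s r]
            weakly_tendstoI[OF weak[rule_format]]])
    moreover have "an ((s \<circ> r) k) (u k) v = 0" for k
      using uV that by (auto simp: V_of_def)
    ultimately show ?thesis by (simp add: LIMSEQ_const_iff)
  qed
  then have "w \<in> V_of j a \<inter> null_space j" using w by (simp add: V_of_def null_space_def)
  with triv w show False by blast
qed

theorem theorem5p5:
  fixes j :: "'v::chilbert_space \<Rightarrow> 'h::chilbert_space"
    and jt :: "'v \<Rightarrow> 'k::chilbert_space"
    and a :: "'v \<Rightarrow> 'v \<Rightarrow> complex"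
    and an :: "nat \<Rightarrow> 'v \<Rightarrow> 'v \<Rightarrow> complex"
  assumes "continuous_clinear j"
    and "compact_clinear jt"
    and "continuous_symmetric_form a"
    and "\<And>n. continuous_symmetric_form (an n)"
    and "uniformly_elliptic jt an"
    and "forms_converge_weakly an a"
    and "V_of j a \<inter> null_space j = {0}"
  shows "uniformly_bounded_below (\<lambda>n. associated_graph (an n) j)"
proof -
  obtain \<mu> \<omega> where pos: "\<mu> > 0" "\<omega> > 0"
    and ell: "\<And>n u. Re (an n u u) + \<omega> * (norm (jt u))\<^sup>2 \<ge> \<mu> * (norm u)\<^sup>2"
    using assms(5) unfolding uniformly_elliptic_def by blast
  obtain N c where tail:
    "\<And>n u. n \<ge> N \<Longrightarrow> u \<in> V_of j (an n) \<Longrightarrow> Re (an n u u) + c * (norm (j u))\<^sup>2 \<ge> 0"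
    using lower_bound_eventually_uniform[OF assms(1,2,4) pos ell assms(6,7)] by blast
  have "\<exists>d. \<forall>u\<in>V_of j (an n). Re (an n u u) + d * (norm (j u))\<^sup>2 \<ge> 0" for n
    by (rule lower_bound_single_form[OF assms(1,2,4) pos ell])
  then obtain d where single:
    "\<And>n u. u \<in> V_of j (an n) \<Longrightarrow> Re (an n u u) + d n * (norm (j u))\<^sup>2 \<ge> 0"
    by metis
  define C where "C = \<bar>c\<bar> + (\<Sum>n<N. \<bar>d n\<bar>)"
  have lower: "Re (an n u u) + C * (norm (j u))\<^sup>2 \<ge> 0" if "u \<in> V_of j (an n)" for n u
  proof -
    have sum_nonneg: "0 \<le> (\<Sum>n<N. \<bar>d n\<bar>)" by (simp add: sum_nonneg)
    have "\<exists>e\<le>C. Re (an n u u) + e * (norm (j u))\<^sup>2 \<ge> 0"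
    proof (cases "n < N")
      case True
      then have "\<bar>d n\<bar> \<le> (\<Sum>n<N. \<bar>d n\<bar>)" by (intro member_le_sum) auto
      then have "d n \<le> C" by (simp add: C_def)
      then show ?thesis using single[OF that] by blast
    next
      case False
      have "c \<le> C" using sum_nonneg abs_ge_self[of c] unfolding C_def by linarith
      then show ?thesis using tail[OF _ that] False by auto
    qed
    then obtain e where "e \<le> C" "Re (an n u u) + e * (norm (j u))\<^sup>2 \<ge> 0" by blast
    then show ?thesis
      using mult_right_mono[of e C "(norm (j u))\<^sup>2"] by simp
  qed
  have "cinner x y \<in> \<real> \<and> Re (cinner x y) + C * (norm x)\<^sup>2 \<ge> 0"
    if xy: "(x, y) \<in> associated_graph (an n) j" for n x y
  proof -
    obtain u where u: "j u = x" "\<And>v. an n u v = cinner y (j v)"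
      using xy by (auto simp: associated_graph_def)
    have "cinner y 0 = 0" using cinner_scaleC_left[of 0 0 y] cinner_commute[of y 0]
      by (metis complex_cnj_zero mult_zero_left scaleC_of_real of_real_0 scaleR_zero_left)
    then have "u \<in> V_of j (an n)" by (simp add: V_of_def null_space_def u(2))
    note lower[OF this]
    moreover have real: "an n u u = cnj (an n u u)"
      using assms(4)[of n] unfolding continuous_symmetric_form_def by blast
    moreover have "cinner x y = an n u u"
      using real u cinner_commute[of x y] by simp
    ultimately show ?thesis using u(1) by (simp add: Reals_cnj_iff)
  qed
  then show ?thesis unfolding uniformly_bounded_below_def by blast
qed

end
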